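(* Let $G$ be a distance-regular graph of diameter $d\ge 1$, and let $\mu_0>\mu_1>\cdots>\mu_d$ be the distinct eigenvalues of its discriminant $P$. Then the Grover walk on $G$ exhibits perfect state transfer at time $\tau$ if and only if (i) $G$ is antipodal with fibres of size $2$, and (ii) $T_\tau(\mu_j)=1$ for every even $j$ and $T_\tau(\mu_j)=-1$ for every odd $j$, $0\le j\le d$. Moreover, if (i) and (ii) hold, then $G$ exhibits perfect state transfer at time $\tau$ between antipodal vertices (vertices at distance $d$).
   Context: A connected graph $G$ is distance-regular if for any vertices $u,v$ the number of vertices at distance $i$ from $u$ and distance $j$ from $v$ depends only on $i,j$ and $\operatorname{dist}(u,v)$. Such a graph of diameter $d$ has exactly $d+1$ distinct adjacency eigenvalues. $G$ is antipodal if any two distinct vertices at distance $d$ from a given vertex are at distance $d$ from each other; then the graph on $V(G)$ joining vertices at distance $d$ is a disjoint union of cliques of equal size, whose vertex sets are the fibres. Grover walk: for a finite simple graph $G$ without isolated vertices, arcs $\mathcal{A}(G)=\{(u,v),(v,u):uv\in E(G)\}$, $t((u,v))=v$, $(u,v)^{-1}=(v,u)$; shift $S_{ab}=\delta_{a,b^{-1}}$; boundary $N_{ua}=\frac{1}{\sqrt{\deg u}}\delta_{u,t(a)}$; $U=S(2N^*N-I)$; discriminant $P=NSN^*$; $\Phi_u=N^*\mathbf{e}_u$. $G$ exhibits perfect state transfer from $u$ to $v\ne u$ at time $\tau\in\mathbb{N}$ if $U^\tau\Phi_u=\gamma\Phi_v$ for some unimodular $\gamma$; it exhibits perfect state transfer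 at time $\tau$ if this holds for some $u\ne v$. $T_m$ is the Chebyshev polynomial of the first kind: $T_0=1$, $T_1=x$, $T_m=2xT_{m-1}-T_{m-2}$. *)

theory Defs
  imports
    Complex_Main
    "HOL-Computational_Algebra.Polynomial"
    "Graph_Theory.Graph_Theory"
begin

text \<open>
  Finite simple graphs are the \<^term>\<open>pair_graph\<close>s of the entry Graph_Theory, i.e. finite symmetric
  loop-free digraphs whose arcs are ordered pairs. The field \<^term>\<open>parcs G\<close> is therefore exactly
  the arc set of the Grover walk, and \<^term>\<open>snd\<close> is the terminus map \<open>t\<close>.
\<close>

section \<open>Distance-regular and antipodal graphs\<close>

text \<open>Only meaningful if some walk from \<open>u\<close> to \<open>v\<close> exists, as in a connected graph.\<close>

definition graph_dist :: "'v pair_pre_digraph \<Rightarrow> 'v \<Rightarrow> 'v \<Rightarrow> nat" where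
  "graph_dist G u v = (LEAST n. \<exists>p. pre_digraph.awalk (with_proj G) u p v \<and> length p = n)"

definition graph_diameter :: "'v pair_pre_digraph \<Rightarrow> nat" where
  "graph_diameter G = Max ((\<lambda>(u, v). graph_dist G u v) ` (pverts G \<times> pverts G))"

definition distance_regular :: "'v pair_pre_digraph \<Rightarrow> bool" where
  "distance_regular G \<longleftrightarrow>
     pair_graph G \<and> Digraph_Component.connected (with_proj G) \<and>
     (\<exists>p :: nat \<Rightarrow> nat \<Rightarrow> nat \<Rightarrow> nat. \<forall>u \<in> pverts G. \<forall>v \<in> pverts G. \<forall>i j.
        card {w \<in> pverts G. graph_dist G u w = i \<and> graph_dist G v w = j}
          = p i j (graph_dist G u v))"

definition antipodal :: "'v pair_pre_digraph \<Rightarrow> bool" where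
  "antipodal G \<longleftrightarrow>
     (\<forall>u \<in> pverts G. \<forall>v \<in> pverts G. \<forall>w \<in> pverts G.
        graph_dist G u v = graph_diameter G \<and> graph_dist G u w = graph_diameter G \<and> v \<noteq> w
          \<longrightarrow> graph_dist G v w = graph_diameter G)"

text \<open>
  In an antipodal graph, ``equal or at distance \<open>d\<close>'' is an equivalence relation on the vertices;
  its classes are the vertex sets of the cliques of the distance-\<open>d\<close> graph.
\<close>

definition antipodal_fibres :: "'v pair_pre_digraph \<Rightarrow> 'v set set" where
  "antipodal_fibres G =
     pverts G // {(u, v) \<in> pverts G \<times> pverts G. u = v \<or> graph_dist G u v = graph_diameter G}"

section \<open>Matrices indexed by finite sets\<close>

text \<open>
  Rows and columns are indexed by finite sets (vertices, arcs) that are not types, so a matrix is a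
  function of two indices and products receive the set summed over. Entries at indices outside the
  intended sets are junk and never used.
\<close>

type_synonym ('i, 'j) cmatrix = "'i \<Rightarrow> 'j \<Rightarrow> complex"
type_synonym 'i cvector = "'i \<Rightarrow> complex"

definition mmult :: "'k set \<Rightarrow> ('i, 'k) cmatrix \<Rightarrow> ('k, 'j) cmatrix \<Rightarrow> ('i, 'j) cmatrix" where
  "mmult K A B = (\<lambda>i j. \<Sum>k\<in>K. A i k * B k j)"

definition mvmult :: "'k set \<Rightarrow> ('i, 'k) cmatrix \<Rightarrow> 'k cvector \<Rightarrow> 'i cvector" where
  "mvmult K A x = (\<lambda>i. \<Sum>k\<in>K. A i k * x k)"

definition madjoint :: "('i, 'j) cmatrix \<Rightarrow> ('j, 'i) cmatrix" where
  "madjoint A = (\<lambda>j i. cnj (A i j))"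

definition mident :: "('i, 'i) cmatrix" where
  "mident = (\<lambda>i j. if i = j then 1 else 0)"

primrec mpower :: "'i set \<Rightarrow> ('i, 'i) cmatrix \<Rightarrow> nat \<Rightarrow> ('i, 'i) cmatrix" where
  "mpower K A 0 = mident"
| "mpower K A (Suc n) = mmult K A (mpower K A n)"

definition is_eigenvalue :: "'i set \<Rightarrow> ('i, 'i) cmatrix \<Rightarrow> complex \<Rightarrow> bool" where
  "is_eigenvalue K A \<theta> \<longleftrightarrow>
     (\<exists>x. (\<exists>i\<in>K. x i \<noteq> 0) \<and> (\<forall>i\<in>K. mvmult K A x i = \<theta> * x i))"

section \<open>The Grover walk\<close>

definition shift_matrix :: "('v \<times> 'v, 'v \<times> 'v) cmatrix" where
  "shift_matrix = (\<lambda>a b. if a = prod.swap b then 1 else 0)"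

text \<open>The out-degree in the symmetric digraph is the degree of the simple graph.\<close>

definition boundary_matrix :: "'v pair_pre_digraph \<Rightarrow> ('v, 'v \<times> 'v) cmatrix" where
  "boundary_matrix G =
     (\<lambda>u a. complex_of_real (1 / sqrt (real (out_degree (with_proj G) u)))
              * (if u = snd a then 1 else 0))"

definition grover_matrix :: "'v pair_pre_digraph \<Rightarrow> ('v \<times> 'v, 'v \<times> 'v) cmatrix" where
  "grover_matrix G =
     mmult (parcs G) shift_matrix
       (\<lambda>a b. 2 * mmult (pverts G) (madjoint (boundary_matrix G)) (boundary_matrix G) a b
               - mident a b)"

definition discriminant :: "'v pair_pre_digraph \<Rightarrow> ('v, 'v) cmatrix" where
  "discriminant G =
     mmult (parcs G) (mmult (parcs G) (boundary_matrix G) shift_matrix)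
       (madjoint (boundary_matrix G))"

definition vertex_state :: "'v pair_pre_digraph \<Rightarrow> 'v \<Rightarrow> ('v \<times> 'v) cvector" where
  "vertex_state G u =
     mvmult (pverts G) (madjoint (boundary_matrix G)) (\<lambda>w. if w = u then 1 else 0)"

definition pst_between :: "'v pair_pre_digraph \<Rightarrow> nat \<Rightarrow> 'v \<Rightarrow> 'v \<Rightarrow> bool" where
  "pst_between G \<tau> u v \<longleftrightarrow>
     u \<in> pverts G \<and> v \<in> pverts G \<and> u \<noteq> v \<and>
     (\<exists>\<gamma>. cmod \<gamma> = 1 \<and>
        (\<forall>a \<in> parcs G.
           mvmult (parcs G) (mpower (parcs G) (grover_matrix G) \<tau>) (vertex_state G u) a
             = \<gamma> * vertex_state G v a))"

definition exhibits_pst :: "'v pair_pre_digraph \<Rightarrow> nat \<Rightarrow> bool" where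
  "exhibits_pst G \<tau> \<longleftrightarrow> (\<exists>u v. pst_between G \<tau> u v)"

section \<open>Chebyshev polynomials of the first kind\<close>

fun cheb_T :: "nat \<Rightarrow> real poly" where
  "cheb_T 0 = 1"
| "cheb_T (Suc 0) = [:0, 1:]"
| "cheb_T (Suc (Suc m)) = [:0, 2:] * cheb_T (Suc m) - cheb_T m"

end

theory Submission
  imports Defs
begin

text \<open>
  In a \<open>k\<close>-regular graph \<open>P = A / k\<close>, and \<open>N U\<^sup>\<tau> N\<^sup>* = T\<^sub>\<tau>(P)\<close>, so state transfer from \<open>u\<close> to \<open>v\<close> forces
  \<open>T\<^sub>\<tau>(P) e\<^sub>u = \<gamma> e\<^sub>v\<close>. The entries of a polynomial in \<open>P\<close> depend only on the distance of the two
  vertices; hence the sphere of radius \<open>dist u v\<close> around any vertex is a single point, which is only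
  possible at radius \<open>d\<close>, and \<open>T\<^sub>\<tau>(P) = A\<^sub>d\<close> because \<open>T\<^sub>\<tau>(1) = 1\<close>. Conversely \<open>A\<^sub>d\<close> is a polynomial in \<open>P\<close>,
  and since it is orthogonal to all polynomials in \<open>P\<close> of degree less than \<open>d\<close>, its eigenvalues
  \<open>\<plusminus>1\<close> alternate in sign along \<open>\<mu>\<^sub>0 > \<dots> > \<mu>\<^sub>d\<close>. So (i) and (ii) together say exactly that \<open>T\<^sub>\<tau>(P) = A\<^sub>d\<close>
  is a fixed-point-free involution.
\<close>

section \<open>Polynomials evaluated at a matrix\<close>

text \<open>Horner's scheme, so that \<open>pCons\<close> drives every induction; the constant term
  enters as a multiple of the identity.\<close>

definition matrix_poly :: "'i set \<Rightarrow> ('i \<Rightarrow> 'i \<Rightarrow> real) \<Rightarrow> real poly \<Rightarrow> 'i \<Rightarrow> 'i \<Rightarrow> real" where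
  "matrix_poly K A h =
     fold_coeffs (\<lambda>a M u v. (if u = v then a else 0) + (\<Sum>w\<in>K. A u w * M w v)) h (\<lambda>u v. 0)"

lemma matrix_poly_0 [simp]: "matrix_poly K A 0 = (\<lambda>u v. 0)"
  by (simp add: matrix_poly_def)

lemma matrix_poly_pCons:
  "matrix_poly K A (pCons a h) u v =
     (if u = v then a else 0) + (\<Sum>w\<in>K. A u w * matrix_poly K A h w v)"
\<comment> \<open>\<open>cCons\<close> drops a zero in front of the empty coefficient list. In that
  one case both sides vanish; otherwise the fold unrolls by one step.\<close>
proof (cases "h = 0 \<and> a = 0")
  case True
  then show ?thesis by simp
next
  case False
  then show ?thesis
    by (auto simp: matrix_poly_def fold_coeffs_def cCons_def)
qed

lemma matrix_poly_1 [simp]: "matrix_poly K A 1 u v = (if u = v then 1 else 0)"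
  using matrix_poly_pCons[of K A 1 0 u v] by (simp add: one_pCons)

lemma matrix_poly_add:
  "matrix_poly K A (f + g) u v = matrix_poly K A f u v + matrix_poly K A g u v"
proof (induction f g arbitrary: u v rule: poly_induct2)
  case 0
  then show ?case by simp
next
  case (pCons a p b q)
  then show ?case
    by (simp add: matrix_poly_pCons algebra_simps sum.distrib)
qed

lemma matrix_poly_smult: "matrix_poly K A (smult c f) u v = c * matrix_poly K A f u v"
  by (induction f arbitrary: u v) (auto simp: matrix_poly_pCons algebra_simps sum_distrib_left)

lemma matrix_poly_diff:
  "matrix_poly K A (f - g) u v = matrix_poly K A f u v - matrix_poly K A g u v"
proof -
  have "f - g = f + smult (-1) g" by simp
  then show ?thesis by (simp only: matrix_poly_add matrix_poly_smult)
qed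

text \<open>The row index must lie in \<open>K\<close>, because the constant term of
  \<open>f\<close> contributes row \<open>u\<close> of the identity and the sum over
  \<open>K\<close> has to meet it.\<close>

lemma matrix_poly_mult:
  assumes "finite K" "u \<in> K"
  shows "matrix_poly K A (f * g) u v = (\<Sum>w\<in>K. matrix_poly K A f u w * matrix_poly K A g w v)"
  using assms(2)
proof (induction f arbitrary: u)
  case 0
  then show ?case by simp
next
  case (pCons a f)
  have "(\<Sum>w\<in>K. matrix_poly K A (pCons a f) u w * matrix_poly K A g w v)
      = (\<Sum>w\<in>K. (if u = w then a * matrix_poly K A g w v else 0))
        + (\<Sum>w\<in>K. \<Sum>x\<in>K. A u x * matrix_poly K A f x w * matrix_poly K A g w v)"
    unfolding sum.distrib[symmetric]
    by (intro sum.cong) (auto simp: matrix_poly_pCons algebra_simps sum_distrib_left)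
  also have "(\<Sum>w\<in>K. (if u = w then a * matrix_poly K A g w v else 0)) = a * matrix_poly K A g u v"
    using pCons.prems assms(1) by simp
  also have "(\<Sum>w\<in>K. \<Sum>x\<in>K. A u x * matrix_poly K A f x w * matrix_poly K A g w v)
      = (\<Sum>x\<in>K. A u x * matrix_poly K A (f * g) x v)"
    by (subst sum.swap) (auto simp: pCons.IH sum_distrib_left mult.assoc intro!: sum.cong)
  finally show ?case
    by (simp add: matrix_poly_add matrix_poly_smult matrix_poly_pCons)
qed

lemma matrix_poly_eigenvector:
  fixes x :: "'i \<Rightarrow> complex" and \<theta> :: real
  assumes "finite K" "\<And>u. u \<in> K \<Longrightarrow> (\<Sum>v\<in>K. of_real (A u v) * x v) = of_real \<theta> * x u" "u \<in> K"
  shows "(\<Sum>v\<in>K. of_real (matrix_poly K A h u v) * x v) = of_real (poly h \<theta>) * x u"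
  using assms(3)
proof (induction h arbitrary: u)
  case 0
  then show ?case by simp
next
  case (pCons a h)
  have "(\<Sum>v\<in>K. of_real (matrix_poly K A (pCons a h) u v) * x v)
      = (\<Sum>v\<in>K. (if u = v then of_real a * x v else 0))
        + (\<Sum>v\<in>K. \<Sum>w\<in>K. of_real (A u w) * (of_real (matrix_poly K A h w v) * x v))"
    unfolding sum.distrib[symmetric]
    by (intro sum.cong) (auto simp: matrix_poly_pCons algebra_simps sum_distrib_left)
  also have "(\<Sum>v\<in>K. (if u = v then of_real a * x v else 0)) = of_real a * x u"
    using pCons.prems assms(1) by simp
  also have "(\<Sum>v\<in>K. \<Sum>w\<in>K. of_real (A u w) * (of_real (matrix_poly K A h w v) * x v))
      = (\<Sum>w\<in>K. of_real (A u w) * (of_real (poly h \<theta>) * x w))"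
    by (subst sum.swap) (auto simp: pCons.IH sum_distrib_left[symmetric] intro!: sum.cong)
  also have "\<dots> = of_real (poly h \<theta>) * (\<Sum>w\<in>K. of_real (A u w) * x w)"
    by (simp add: sum_distrib_left mult.left_commute)
  also have "\<dots> = of_real (poly h \<theta>) * (of_real \<theta> * x u)"
    using assms(2)[OF pCons.prems] by simp
  finally show ?case by (simp add: algebra_simps)
qed

section \<open>Distances in connected graphs\<close>

locale connected_pair_graph = pair_graph G for G :: "'v pair_pre_digraph" (structure) +
  assumes conn: "Digraph_Component.connected (with_proj G)"
begin

abbreviation V where "V \<equiv> pverts G"
abbreviation E where "E \<equiv> parcs G"
abbreviation D where "D \<equiv> graph_dist G"

lemma arc_sym: "(u, v) \<in> E \<Longrightarrow> (v, u) \<in> E"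
  using pair_sym_arcs by (auto simp: symmetric_def dest: symD)

lemma arc_swap: "a \<in> E \<Longrightarrow> prod.swap a \<in> E"
  using arc_sym by (cases a) auto

lemma exists_awalk:
  assumes "u \<in> V" "v \<in> V"
  shows "\<exists>p. awalk u p v"
proof -
  have "strongly_connected (with_proj G)"
    using conn pair_sym_arcs by (intro symmetric_connected_imp_strongly_connected)
  then show ?thesis
    using assms by (auto simp: strongly_connected_def reachable_awalk)
qed

lemma dist_awalk:
  assumes "u \<in> V" "v \<in> V"
  shows "\<exists>p. awalk u p v \<and> length p = D u v"
  unfolding graph_dist_def
  by (rule LeastI_ex) (use exists_awalk[OF assms] in auto)

lemma dist_le: "awalk u p v \<Longrightarrow> D u v \<le> length p"
  unfolding graph_dist_def by (rule Least_le) auto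

lemma awalk_rev: "awalk u p v \<Longrightarrow> \<exists>q. awalk v q u \<and> length q = length p"
proof (induction p arbitrary: u)
  case Nil
  then show ?case by (auto simp: awalk_Nil_iff)
next
  case (Cons e p)
  then obtain q where q: "awalk v q (snd e)" "length q = length p"
    by (auto simp: awalk_Cons_iff)
  have e: "(u, snd e) \<in> E" using Cons.prems by (auto simp: awalk_Cons_iff)
  then have "awalk (snd e) [(snd e, u)] u"
    using arc_sym by (auto simp: awalk_Cons_iff awalk_Nil_iff in_arcsD1)
  with q have "awalk v (q @ [(snd e, u)]) u"
    by (blast intro: awalk_appendI)
  then show ?case using q by (intro exI[of _ "q @ [(snd e, u)]"]) auto
qed

lemma dist_sym:
  assumes "u \<in> V" "v \<in> V"
  shows "D u v = D v u"
proof -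
  have "D u v \<le> D v u" if uv: "u \<in> V" "v \<in> V" for u v
  proof -
    obtain p where p: "awalk v p u" "length p = D v u" using dist_awalk[OF uv(2,1)] by blast
    obtain q where q: "awalk u q v" "length q = length p" using awalk_rev[OF p(1)] by blast
    then show ?thesis using dist_le[OF q(1)] p by simp
  qed
  then show ?thesis using assms by (simp add: order_antisym)
qed

lemma dist_eq_0_iff:
  assumes "u \<in> V" "v \<in> V"
  shows "D u v = 0 \<longleftrightarrow> u = v"
proof
  assume "D u v = 0"
  then show "u = v" using dist_awalk[OF assms] by (auto simp: awalk_Nil_iff)
next
  assume "u = v"
  then show "D u v = 0" using dist_le[of u "[]" v] assms by (auto simp: awalk_Nil_iff)
qed

lemma dist_le_Suc:
  assumes "(u, w) \<in> E" "v \<in> V"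
  shows "D u v \<le> Suc (D w v)"
proof -
  obtain p where p: "awalk w p v" "length p = D w v"
    using dist_awalk[OF in_arcsD2[OF assms(1)] assms(2)] by blast
  then have "awalk u ((u, w) # p) v" using assms by (auto simp: awalk_Cons_iff)
  from dist_le[OF this] show ?thesis using p by simp
qed

lemma dist_SucE:
  assumes "u \<in> V" "v \<in> V" "D u v = Suc n"
  obtains w where "(u, w) \<in> E" "w \<in> V" "D w v = n"
proof -
  obtain p where p: "awalk u p v" "length p = Suc n" using dist_awalk[OF assms(1,2)] assms(3) by auto
  then obtain e q where "p = e # q" by (cases p) auto
  with p have q: "(u, snd e) \<in> E" "awalk (snd e) q v" "length q = n"
    by (auto simp: awalk_Cons_iff)
  have "D (snd e) v = n"
    using dist_le[OF q(2)] q(3) dist_le_Suc[OF q(1) assms(2)] assms(3) by simp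
  with q(1) show ?thesis using that in_arcsD2 by blast
qed

lemma dist_eq_1_iff:
  assumes "u \<in> V" "v \<in> V"
  shows "D u v = 1 \<longleftrightarrow> (u, v) \<in> E"
proof
  assume "D u v = 1"
  then obtain w where "(u, w) \<in> E" "w \<in> V" "D w v = 0"
    using assms by (auto elim: dist_SucE)
  then show "(u, v) \<in> E" using dist_eq_0_iff assms by auto
next
  assume uv: "(u, v) \<in> E"
  then have "u \<noteq> v" using pair_no_loops[OF uv] by simp
  then show "D u v = 1"
    using dist_le_Suc[OF uv assms(2)] dist_eq_0_iff[OF assms] dist_eq_0_iff[OF assms(2,2)] by simp
qed

lemma exists_dist_less:
  assumes "u \<in> V" "v \<in> V" "i \<le> D u v"
  shows "\<exists>w\<in>V. D w v = i"
  using assms(1,3)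
proof (induction "D u v" arbitrary: u)
  case 0
  then show ?case by auto
next
  case (Suc n)
  show ?case
  proof (cases "i = Suc n")
    case True
    then show ?thesis using Suc by auto
  next
    case False
    obtain w where "w \<in> V" "D w v = n"
      using dist_SucE[OF Suc.prems(1) assms(2) Suc.hyps(2)[symmetric]] by blast
    then show ?thesis using Suc False by auto
  qed
qed

lemma dist_le_diameter: "u \<in> V \<Longrightarrow> v \<in> V \<Longrightarrow> D u v \<le> graph_diameter G"
  unfolding graph_diameter_def using pair_finite_verts by (intro Max_ge) auto

lemma verts_nonempty: "V \<noteq> {}"
  using conn by (auto simp: connected_def strongly_connected_def)

lemma diameter_attained: "\<exists>u\<in>V. \<exists>v\<in>V. D u v = graph_diameter G"
proof -
  have "graph_diameter G \<in> (\<lambda>(u, v). D u v) ` (V \<times> V)"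
    unfolding graph_diameter_def using pair_finite_verts verts_nonempty by (intro Max_in) auto
  then show ?thesis by force
qed

end

section \<open>The adjacency algebra of a distance-regular graph\<close>

locale distance_regular_graph = connected_pair_graph G for G :: "'v pair_pre_digraph" +
  fixes p :: "nat \<Rightarrow> nat \<Rightarrow> nat \<Rightarrow> nat"
  assumes intersection_number:
    "\<And>u v i j. u \<in> V \<Longrightarrow> v \<in> V \<Longrightarrow> card {w \<in> V. D u w = i \<and> D v w = j} = p i j (D u v)"
    and diameter_pos: "graph_diameter G \<ge> 1"
begin

abbreviation d where "d \<equiv> graph_diameter G"

text \<open>\<open>p i i 0\<close> is the size of a sphere of radius \<open>i\<close>, as both
  conditions concern the same vertex; \<open>i = 1\<close> gives the degree.\<close>

definition valency :: nat where "valency = p 1 1 0"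

text \<open>The real form of \<open>discriminant\<close> (see \<open>discriminant_eq\<close>),
  suited to positivity arguments.\<close>

definition P :: "'v \<Rightarrow> 'v \<Rightarrow> real" where
  "P u v = (if (u, v) \<in> E then 1 / real valency else 0)"

abbreviation "mp \<equiv> matrix_poly V P"

lemma finite_V [simp]: "finite V"
  by (rule pair_finite_verts)

lemma finite_E [simp]: "finite E"
  by (rule pair_finite_arcs)

lemma sphere_card: "u \<in> V \<Longrightarrow> card {w \<in> V. D u w = i} = p i i 0"
  using intersection_number[of u u i i] dist_eq_0_iff[of u u] by simp

lemma out_neighbours: "u \<in> V \<Longrightarrow> {w. (u, w) \<in> E} = {w \<in> V. D u w = 1}"
  using dist_eq_1_iff in_arcsD2 by blast

lemma card_neighbours: "u \<in> V \<Longrightarrow> card {w. (u, w) \<in> E} = valency"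
  by (simp add: out_neighbours sphere_card valency_def)

lemma out_degree_eq: "u \<in> V \<Longrightarrow> out_degree (with_proj G) u = valency"
proof -
  assume u: "u \<in> V"
  have "out_arcs (with_proj G) u = Pair u ` {w. (u, w) \<in> E}"
    by (auto simp: out_arcs_def)
  then show ?thesis
    using card_neighbours[OF u] by (simp add: out_degree_def card_image inj_on_def)
qed

text \<open>Sphere sizes do not depend on the centre, so it suffices to find nonempty spheres around
  one end of a pair at distance \<open>d\<close>.\<close>

lemma exists_at_dist:
  assumes "u \<in> V" "i \<le> d"
  shows "\<exists>w\<in>V. D u w = i"
proof -
  obtain x y where xy: "x \<in> V" "y \<in> V" "D x y = d" using diameter_attained by blast
  then obtain z where "z \<in> V" "D z y = i" using exists_dist_less assms(2) by metis
  then have "{w \<in> V. D y w = i} \<noteq> {}" using xy dist_sym by auto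
  then have "card {w \<in> V. D y w = i} \<noteq> 0" by simp
  then have "p i i 0 \<noteq> 0" using sphere_card[OF xy(2), of i] by simp
  then have "card {w \<in> V. D u w = i} \<noteq> 0" using sphere_card[OF assms(1), of i] by simp
  then have "{w \<in> V. D u w = i} \<noteq> {}" by force
  then show ?thesis by auto
qed

lemma valency_pos: "valency > 0"
proof -
  obtain u where u: "u \<in> V" using verts_nonempty by auto
  obtain w where "w \<in> V" "D u w = 1" using exists_at_dist[OF u diameter_pos] by auto
  then have "{w. (u, w) \<in> E} \<noteq> {}" using dist_eq_1_iff[OF u] by auto
  moreover have "finite {w. (u, w) \<in> E}" using out_neighbours[OF u] by simp
  ultimately show ?thesis using card_neighbours[OF u] by (metis card_gt_0_iff)
qed

section \<open>Entries of \<open>P\<close> and of polynomials in \<open>P\<close>\<close>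

lemma P_nonneg [simp]: "P u v \<ge> 0"
  by (simp add: P_def)

lemma P_sum_eq:
  fixes f :: "'v \<Rightarrow> 'b :: real_field"
  assumes "u \<in> V"
  shows "(\<Sum>w\<in>V. of_real (P u w) * f w) = (\<Sum>w | (u, w) \<in> E. f w) / of_nat valency"
proof -
  have "(\<Sum>w\<in>V. of_real (P u w) * f w) = (\<Sum>w\<in>{w. (u, w) \<in> E}. f w / of_nat valency)"
    by (rule sum.mono_neutral_cong_right) (auto simp: P_def in_arcsD2)
  then show ?thesis by (simp add: sum_divide_distrib)
qed

lemma P_row_sum: "u \<in> V \<Longrightarrow> (\<Sum>w\<in>V. P u w) = 1"
  using P_sum_eq[of u "\<lambda>_. 1 :: real"] valency_pos by (simp add: card_neighbours)

text \<open>The Bose-Mesner algebra at work: multiplying by \<open>P\<close> averages over the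
  neighbours of \<open>u\<close>, of which \<open>p 1 j (D u v)\<close> lie at distance
  \<open>j\<close> from \<open>v\<close>.\<close>

lemma matrix_poly_dist:
  "\<exists>\<phi>. \<forall>u\<in>V. \<forall>v\<in>V. mp h u v = \<phi> (D u v)"
proof (induction h)
  case 0
  then show ?case by auto
next
  case (pCons a h)
  then obtain \<phi> where \<phi>: "\<And>u v. u \<in> V \<Longrightarrow> v \<in> V \<Longrightarrow> mp h u v = \<phi> (D u v)" by blast
  have "mp (pCons a h) u v =
      (if D u v = 0 then a else 0) + (\<Sum>j\<le>d. real (p 1 j (D u v)) * \<phi> j) / real valency"
    if uv: "u \<in> V" "v \<in> V" for u v
  proof -
    have "(\<Sum>w\<in>V. P u w * mp h w v) = (\<Sum>w | (u, w) \<in> E. mp h w v) / real valency"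
      using P_sum_eq[OF uv(1), of "\<lambda>w. mp h w v"] by simp
    also have "(\<Sum>w | (u, w) \<in> E. mp h w v) = (\<Sum>w\<in>{w \<in> V. D u w = 1}. \<phi> (D v w))"
      using uv \<phi> dist_sym by (intro sum.cong) (auto simp: out_neighbours)
    also have "\<dots> = (\<Sum>j\<le>d. \<Sum>w\<in>{w \<in> {w \<in> V. D u w = 1}. D v w = j}. \<phi> (D v w))"
      using uv dist_le_diameter by (intro sum.group[symmetric]) auto
    also have "\<dots> = (\<Sum>j\<le>d. real (p 1 j (D u v)) * \<phi> j)"
    proof (rule sum.cong)
      fix j
      have "{w \<in> {w \<in> V. D u w = 1}. D v w = j} = {w \<in> V. D u w = 1 \<and> D v w = j}" by auto
      then show "(\<Sum>w\<in>{w \<in> {w \<in> V. D u w = 1}. D v w = j}. \<phi> (D v w))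
          = real (p 1 j (D u v)) * \<phi> j"
        using intersection_number[OF uv, of 1 j] by simp
    qed simp
    finally show ?thesis using dist_eq_0_iff[OF uv] by (simp add: matrix_poly_pCons)
  qed
  then show ?case
    by (intro exI[of _ "\<lambda>i. (if i = 0 then a else 0) + (\<Sum>j\<le>d. real (p 1 j i) * \<phi> j) / real valency"])
      blast
qed

lemma matrix_poly_sym:
  assumes "u \<in> V" "v \<in> V"
  shows "mp h u v = mp h v u"
  using matrix_poly_dist[of h] dist_sym[OF assms] assms by metis

text \<open>An arc lowers the distance to \<open>v\<close> by at most one, so \<open>n\<close>
  factors of \<open>P\<close> reach no farther than \<open>n\<close>.\<close>

lemma matrix_poly_eq_0:
  assumes "u \<in> V" "v \<in> V" "degree h < D u v"
  shows "mp h u v = 0"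
  using assms
proof (induction h arbitrary: u)
  case 0
  then show ?case by simp
next
  case (pCons a h)
  have "P u w * mp h w v = 0" if "w \<in> V" for w
  proof (cases "h = 0 \<or> (u, w) \<notin> E")
    case True
    then show ?thesis by (auto simp: P_def)
  next
    case False
    then have "degree h < D w v"
      using pCons.prems dist_le_Suc[of u w v] by simp
    then show ?thesis using pCons that by simp
  qed
  moreover have "u \<noteq> v" using pCons.prems dist_eq_0_iff[of u v] by auto
  ultimately show ?case by (simp add: matrix_poly_pCons sum.neutral del: mult_eq_0_iff)
qed

lemma matrix_poly_monom_nonneg: "mp (monom 1 n) u v \<ge> 0"
proof (induction n arbitrary: u)
  case 0
  then show ?case by (simp add: monom_0 matrix_poly_pCons)
next
  case (Suc n)
  then show ?case by (simp add: monom_Suc matrix_poly_pCons sum_nonneg)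
qed

text \<open>Powers of \<open>P\<close> weigh walks; no weight is negative, and a geodesic has a
  positive one.\<close>

lemma matrix_poly_monom_pos:
  assumes "u \<in> V" "v \<in> V" "D u v = n"
  shows "mp (monom 1 n) u v > 0"
  using assms
proof (induction n arbitrary: u)
  case 0
  then show ?case by (simp add: monom_0 matrix_poly_pCons dist_eq_0_iff)
next
  case (Suc n)
  obtain w where w: "(u, w) \<in> E" "w \<in> V" "D w v = n" by (rule dist_SucE[OF Suc.prems])
  have "0 < P u w * mp (monom 1 n) w v"
    using Suc.IH[OF w(2) Suc.prems(2) w(3)] w(1) valency_pos P_def[of u w] by simp
  also have "\<dots> \<le> (\<Sum>w\<in>V. P u w * mp (monom 1 n) w v)"
    using w(2) by (intro member_le_sum) (auto simp: matrix_poly_monom_nonneg)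
  finally show ?case by (simp add: monom_Suc matrix_poly_pCons)
qed

text \<open>Triangularity: \<open>P^n\<close> is nonzero at distance \<open>n\<close> and zero
  beyond, so any function of the distance is reached by elimination from the largest distance down.
  The alternative \<open>f = 0\<close> serves \<open>n = 0\<close>, where no degree is small
  enough.\<close>

lemma exists_matrix_poly:
  assumes "n \<le> Suc d" "\<And>j. n \<le> j \<Longrightarrow> j \<le> d \<Longrightarrow> \<phi> j = 0"
  shows "\<exists>f. (f = 0 \<or> degree f < n) \<and> (\<forall>u\<in>V. \<forall>v\<in>V. mp f u v = \<phi> (D u v))"
  using assms
proof (induction n arbitrary: \<phi>)
  case 0
  then show ?case using dist_le_diameter by (intro exI[of _ 0]) auto
next
  case (Suc n)
  obtain \<psi> where \<psi>: "\<And>u v. u \<in> V \<Longrightarrow> v \<in> V \<Longrightarrow> mp (monom 1 n) u v = \<psi> (D u v)"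
    using matrix_poly_dist by blast
  obtain x where x: "x \<in> V" using verts_nonempty by auto
  have "\<psi> n > 0"
  proof -
    obtain y where "y \<in> V" "D x y = n" using exists_at_dist[OF x, of n] Suc.prems(1) by auto
    then show ?thesis using matrix_poly_monom_pos[OF x] \<psi>[OF x] by metis
  qed
  have \<psi>0: "\<psi> j = 0" if j: "n < j" "j \<le> d" for j
  proof -
    obtain y where y: "y \<in> V" "D x y = j" using exists_at_dist[OF x j(2)] by auto
    then have "mp (monom 1 n) x y = 0"
      using j x by (intro matrix_poly_eq_0) (auto simp: degree_monom_eq)
    then show ?thesis using \<psi>[OF x y(1)] y(2) by simp
  qed
  \<comment> \<open>Subtracting this multiple of \<open>P^n\<close> clears the value at distance
    \<open>n\<close> and keeps the zeros beyond it.\<close>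
  define \<phi>' where "\<phi>' = (\<lambda>j. \<phi> j - \<phi> n / \<psi> n * \<psi> j)"
  have "\<phi>' j = 0" if "n \<le> j" "j \<le> d" for j
    using that Suc.prems(2)[of j] \<psi>0[of j] \<open>\<psi> n > 0\<close> by (cases "j = n") (auto simp: \<phi>'_def)
  then obtain f where f: "f = 0 \<or> degree f < n"
      "\<And>u v. u \<in> V \<Longrightarrow> v \<in> V \<Longrightarrow> mp f u v = \<phi>' (D u v)"
    using Suc.IH[of \<phi>'] Suc.prems(1) by auto
  let ?g = "f + smult (\<phi> n / \<psi> n) (monom 1 n)"
  have "degree ?g \<le> n"
    using f(1) by (intro degree_add_le order.trans[OF degree_smult_le degree_monom_le]) auto
  moreover have "mp ?g u v = \<phi> (D u v)" if "u \<in> V" "v \<in> V" for u v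
    using f(2)[OF that] \<psi>[OF that] by (simp add: matrix_poly_add matrix_poly_smult \<phi>'_def)
  ultimately show ?case by (intro exI[of _ ?g]) auto
qed

text \<open>\<open>P^(d+1)\<close> too depends only on the distance, hence agrees with a polynomial
  in \<open>P\<close> of degree at most \<open>d\<close>; subtracting that leaves the leading term
  intact.\<close>

lemma exists_annihilator:
  "\<exists>g. degree g = Suc d \<and> (\<forall>u\<in>V. \<forall>v\<in>V. mp g u v = 0)"
proof -
  obtain \<psi> where \<psi>: "\<And>u v. u \<in> V \<Longrightarrow> v \<in> V \<Longrightarrow> mp (monom 1 (Suc d)) u v = \<psi> (D u v)"
    using matrix_poly_dist by blast
  obtain f where f: "f = 0 \<or> degree f < Suc d" "\<And>u v. u \<in> V \<Longrightarrow> v \<in> V \<Longrightarrow> mp f u v = \<psi> (D u v)"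
    using exists_matrix_poly[of "Suc d" \<psi>] by auto
  have "degree (monom 1 (Suc d) - f) = Suc d"
    using f(1) degree_add_eq_left[of "- f" "monom (1::real) (Suc d)"]
    by (auto simp: degree_monom_eq)
  moreover have "mp (monom 1 (Suc d) - f) u v = 0" if "u \<in> V" "v \<in> V" for u v
    using f(2)[OF that] \<psi>[OF that] by (simp add: matrix_poly_diff)
  ultimately show ?thesis by blast
qed

text \<open>
  If the sphere of radius \<open>i\<close> is a point, then the neighbours of \<open>u\<close> all have the same distance
  to the opposite point of \<open>u\<close>; for \<open>i < d\<close> this fails, as both \<open>i - 1\<close> and \<open>i + 1\<close> occur.
\<close>

lemma singleton_sphere_imp_diameter:
  assumes "p i i 0 = 1" "1 \<le> i" "i \<le> d"
  shows "i = d"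
proof (rule ccontr)
  assume "i \<noteq> d"
  then have "Suc i \<le> d" using assms by simp
  obtain x where x: "x \<in> V" using verts_nonempty by auto
  then obtain w where w: "w \<in> V" "D x w = Suc i" using exists_at_dist \<open>Suc i \<le> d\<close> by blast
  then have "D w x = Suc i" using dist_sym x by simp
  then obtain v where v: "(w, v) \<in> E" "v \<in> V" "D v x = i" by (rule dist_SucE[OF w(1) x])
  obtain y where y: "(v, y) \<in> E" "y \<in> V" "D y x = i - 1"
    using dist_SucE[OF v(2) x, of "i - 1"] v(3) assms(2) by auto
  \<comment> \<open>\<open>x\<close> witnesses \<open>p i (Suc i) 1 \<noteq> 0\<close> on the edge
    from \<open>v\<close> to \<open>w\<close>. The same number read on the edge from
    \<open>v\<close> to \<open>y\<close> yields a \<open>z\<close> that must be \<open>x\<close>,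
    yet \<open>x\<close> is at distance \<open>i - 1\<close> from \<open>y\<close>.\<close>
  have "x \<in> {z \<in> V. D v z = i \<and> D w z = Suc i}" using x v \<open>D w x = Suc i\<close> by simp
  then have "card {z \<in> V. D v z = i \<and> D w z = Suc i} \<noteq> 0" by auto
  then have "p i (Suc i) 1 \<noteq> 0"
    using intersection_number[OF v(2) w(1), of i "Suc i"] dist_eq_1_iff[OF v(2) w(1)] arc_sym[OF v(1)]
    by simp
  then have "card {z \<in> V. D v z = i \<and> D y z = Suc i} \<noteq> 0"
    using intersection_number[OF v(2) y(2), of i "Suc i"] dist_eq_1_iff[OF v(2) y(2)] y(1) by simp
  then have "{z \<in> V. D v z = i \<and> D y z = Suc i} \<noteq> {}" by force
  then obtain z where z: "z \<in> V" "D v z = i" "D y z = Suc i" by auto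
  have "card {z \<in> V. D v z = i} = 1" using sphere_card[OF v(2)] assms(1) by simp
  then obtain c where c: "{z \<in> V. D v z = i} = {c}" by (rule card_1_singletonE)
  have "z \<in> {z \<in> V. D v z = i}" "x \<in> {z \<in> V. D v z = i}" using z v x by auto
  then have "z = x" unfolding c by simp
  then show False using z y by simp
qed

text \<open>A fibre is a vertex together with its sphere of radius \<open>d\<close>, so it has
  \<open>p d d 0 + 1\<close> elements. A one-point sphere contains no two distinct vertices, which
  settles antipodality.\<close>

lemma antipodal_iff:
  "antipodal G \<and> (\<forall>F \<in> antipodal_fibres G. card F = 2) \<longleftrightarrow> p d d 0 = 1"
proof -
  let ?R = "{(u, v) \<in> V \<times> V. u = v \<or> D u v = d}"
  have fibre: "card (?R `` {u}) = Suc (p d d 0)" if u: "u \<in> V" for u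
  proof -
    have "?R `` {u} = insert u {w \<in> V. D u w = d}" using u by auto
    moreover have "u \<notin> {w \<in> V. D u w = d}" using dist_eq_0_iff[OF u u] diameter_pos by auto
    ultimately show ?thesis using sphere_card[OF u] by simp
  qed
  have "(\<forall>F \<in> antipodal_fibres G. card F = 2) \<longleftrightarrow> p d d 0 = 1"
    using fibre verts_nonempty by (auto simp: antipodal_fibres_def quotient_def)
  moreover have "antipodal G" if "p d d 0 = 1"
    unfolding antipodal_def
  proof (intro ballI impI)
    fix u v w
    assume uvw: "u \<in> V" "v \<in> V" "w \<in> V" "D u v = d \<and> D u w = d \<and> v \<noteq> w"
    have "card {w \<in> V. D u w = d} = 1" using sphere_card[OF uvw(1)] that by simp
    then obtain c where c: "{w \<in> V. D u w = d} = {c}" by (rule card_1_singletonE)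
    have "v \<in> {w \<in> V. D u w = d}" "w \<in> {w \<in> V. D u w = d}" using uvw by auto
    then have False unfolding c using uvw by simp
    then show "D v w = d" ..
  qed
  ultimately show ?thesis by blast
qed

end

section \<open>The spectrum of the discriminant\<close>

lemma prod_linear_dvd:
  fixes g :: "real poly"
  assumes "finite S" "\<And>a. a \<in> S \<Longrightarrow> poly g a = 0"
  shows "(\<Prod>a\<in>S. [:- a, 1:]) dvd g"
  using assms
proof (induction S rule: finite_induct)
  case empty
  then show ?case by simp
next
  case (insert a S)
  then obtain q where q: "g = (\<Prod>a\<in>S. [:- a, 1:]) * q" by (auto simp: dvd_def)
  have "poly (\<Prod>a\<in>S. [:- a, 1:]) a \<noteq> 0" using insert by (auto simp: poly_prod)
  then have "poly q a = 0" using insert.prems[of a] q by auto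
  then obtain r where "q = [:- a, 1:] * r" unfolding poly_eq_0_iff_dvd dvd_def by blast
  then have "g = ([:- a, 1:] * (\<Prod>a\<in>S. [:- a, 1:])) * r" using q by (simp only: mult_ac)
  then show ?case unfolding prod.insert[OF insert.hyps] by (simp only: dvd_triv_left)
qed

section \<open>The discriminant as a matrix, its row sums and largest eigenvalue\<close>

context distance_regular_graph
begin

lemma boundary_matrix_eq:
  assumes "u \<in> V"
  shows "boundary_matrix G u a = of_real ((if u = snd a then 1 else 0) / sqrt (real valency))"
  using out_degree_eq[OF assms] by (simp add: boundary_matrix_def)

lemma sqrt_valency_square:
  "complex_of_real (sqrt valency) * complex_of_real (sqrt valency) = of_nat valency"
proof -
  have "sqrt (real valency) * sqrt (real valency) = real valency" by simp
  then show ?thesis by (metis of_real_mult of_real_of_nat_eq)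
qed

lemma discriminant_eq:
  assumes "u \<in> V" "v \<in> V"
  shows "discriminant G u v = of_real (P u v)"
proof -
  have inner: "(\<Sum>b\<in>E. boundary_matrix G u b * shift_matrix b c) = boundary_matrix G u (prod.swap c)"
    if "c \<in> E" for c
  proof -
    have "(\<Sum>b\<in>E. boundary_matrix G u b * shift_matrix b c)
        = (\<Sum>b\<in>E. if b = prod.swap c then boundary_matrix G u b else 0)"
      by (intro sum.cong) (auto simp: shift_matrix_def)
    then show ?thesis using arc_swap[OF that] by simp
  qed
  have "discriminant G u v
      = (\<Sum>c\<in>E. boundary_matrix G u (prod.swap c) * cnj (boundary_matrix G v c))"
    unfolding discriminant_def mmult_def madjoint_def using inner by (intro sum.cong) auto
  \<comment> \<open>The reverse of \<open>c\<close> ends in \<open>u\<close> and \<open>c\<close>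
    ends in \<open>v\<close> only for the arc \<open>(u, v)\<close>; the two factors
    \<open>1 / sqrt valency\<close> combine.\<close>
  also have "\<dots> = (\<Sum>c\<in>E. if c = (u, v) then 1 / of_nat valency else 0)"
  proof (rule sum.cong)
    fix c
    show "boundary_matrix G u (prod.swap c) * cnj (boundary_matrix G v c)
        = (if c = (u, v) then 1 / of_nat valency else 0)"
      using assms sqrt_valency_square by (cases c) (auto simp: boundary_matrix_eq)
  qed simp
  also have "\<dots> = of_real (P u v)" by (simp add: P_def)
  finally show ?thesis .
qed

lemma eigenvalue_iff:
  "is_eigenvalue V (discriminant G) \<theta> \<longleftrightarrow>
     (\<exists>x. (\<exists>u\<in>V. x u \<noteq> 0) \<and> (\<forall>u\<in>V. (\<Sum>v\<in>V. of_real (P u v) * x v) = \<theta> * x u))"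
  by (simp add: is_eigenvalue_def mvmult_def discriminant_eq)

lemma one_is_eigenvalue: "is_eigenvalue V (discriminant G) 1"
proof -
  have "(\<Sum>v\<in>V. of_real (P u v)) = (1 :: complex)" if "u \<in> V" for u
    using P_row_sum[OF that] by (simp flip: of_real_sum)
  then show ?thesis
    unfolding eigenvalue_iff using verts_nonempty by (intro exI[of _ "\<lambda>_. 1"]) auto
qed

text \<open>Perron bound: at a coordinate of largest modulus, a nonnegative row of sum one cannot
  enlarge the vector.\<close>

lemma eigenvalue_le_1:
  assumes "is_eigenvalue V (discriminant G) (of_real t)"
  shows "t \<le> 1"
proof -
  obtain x :: "'v \<Rightarrow> complex" and z where x: "z \<in> V" "x z \<noteq> 0"
      "\<And>u. u \<in> V \<Longrightarrow> (\<Sum>v\<in>V. of_real (P u v) * x v) = of_real t * x u"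
    using assms unfolding eigenvalue_iff by blast
  obtain u where u: "u \<in> V" "\<And>v. v \<in> V \<Longrightarrow> cmod (x v) \<le> cmod (x u)"
  proof -
    have "Max ((\<lambda>v. cmod (x v)) ` V) \<in> (\<lambda>v. cmod (x v)) ` V"
      using verts_nonempty by (intro Max_in) auto
    then obtain u where "u \<in> V" "Max ((\<lambda>v. cmod (x v)) ` V) = cmod (x u)" by blast
    moreover have "cmod (x v) \<le> Max ((\<lambda>v. cmod (x v)) ` V)" if "v \<in> V" for v
      using that by (intro Max_ge) auto
    ultimately show thesis by (intro that[of u]) auto
  qed
  have "\<bar>t\<bar> * cmod (x u) = cmod (\<Sum>v\<in>V. of_real (P u v) * x v)"
    using x(3)[OF u(1)] by (simp add: norm_mult)
  also have "\<dots> \<le> (\<Sum>v\<in>V. P u v * cmod (x u))"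
    using u(2) by (intro sum_norm_le) (auto simp: norm_mult intro!: mult_left_mono)
  also have "\<dots> = 1 * cmod (x u)"
    using P_row_sum[OF u(1)] by (simp flip: sum_distrib_right)
  finally have "\<bar>t\<bar> * cmod (x u) \<le> 1 * cmod (x u)" .
  moreover have "cmod (x u) > 0" using x(2) order.strict_trans2[OF _ u(2)[OF x(1)], of 0] by simp
  ultimately show ?thesis by (meson abs_le_D1 mult_le_cancel_right_pos)
qed

lemma matrix_poly_row_sum:
  assumes "u \<in> V"
  shows "(\<Sum>v\<in>V. mp h u v) = poly h 1"
proof -
  have "(\<Sum>v\<in>V. of_real (P w v) * 1) = of_real 1 * (1 :: complex)" if "w \<in> V" for w
    using P_row_sum[OF that] by (simp flip: of_real_sum)
  from matrix_poly_eigenvector[where x = "\<lambda>_. 1" and h = h, OF finite_V this assms]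
  have "complex_of_real (\<Sum>v\<in>V. mp h u v) = complex_of_real (poly h 1)" by (simp only: of_real_sum mult_1_right)
  then show ?thesis by (simp only: of_real_eq_iff)
qed

lemma antipode:
  assumes "p d d 0 = 1" "u \<in> V"
  obtains a where "a \<in> V" "\<And>w. w \<in> V \<Longrightarrow> D u w = d \<longleftrightarrow> w = a" "\<And>w. w \<in> V \<Longrightarrow> D a w = d \<longleftrightarrow> w = u"
proof -
  have 1: "\<exists>a. {w \<in> V. D v w = d} = {a}" if "v \<in> V" for v
    using sphere_card[OF that, of d] assms(1) by (simp add: card_1_singleton_iff)
  obtain a where a: "{w \<in> V. D u w = d} = {a}" using 1[OF assms(2)] by blast
  then have aV: "a \<in> V" "D u a = d" by auto
  obtain b where b: "{w \<in> V. D a w = d} = {b}" using 1[OF aV(1)] by blast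
  then have "b = u" using aV dist_sym[OF assms(2) aV(1)] assms(2) by auto
  then show ?thesis using that[OF aV(1)] a b by blast
qed

end

section \<open>Polynomials on the spectrum and the sign pattern of \<open>A_d\<close>\<close>

locale distance_regular_spectrum = distance_regular_graph G p
  for G :: "'v pair_pre_digraph" and p +
  fixes \<mu> :: "nat \<Rightarrow> real"
  assumes \<mu>_decreasing: "\<And>i j. i < j \<Longrightarrow> j \<le> d \<Longrightarrow> \<mu> j < \<mu> i"
    and spectrum: "{\<theta>. is_eigenvalue V (discriminant G) \<theta>} = (\<lambda>j. complex_of_real (\<mu> j)) ` {..d}"
begin

lemma \<mu>_inj: "inj_on \<mu> {..d}"
  by (rule linorder_inj_onI) (use \<mu>_decreasing in force)+

lemma poly_\<mu>_eq_0:
  assumes "\<And>u v. u \<in> V \<Longrightarrow> v \<in> V \<Longrightarrow> mp h u v = 0" "j \<le> d"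
  shows "poly h (\<mu> j) = 0"
proof -
  have "is_eigenvalue V (discriminant G) (of_real (\<mu> j))" using spectrum assms(2) by blast
  then obtain x :: "'v \<Rightarrow> complex" and u where x: "u \<in> V" "x u \<noteq> 0"
      "\<And>u. u \<in> V \<Longrightarrow> (\<Sum>v\<in>V. of_real (P u v) * x v) = of_real (\<mu> j) * x u"
    unfolding eigenvalue_iff by blast
  show ?thesis
    using matrix_poly_eigenvector[OF finite_V x(3,1), of h] assms(1)[OF x(1)] x(2) by simp
qed

text \<open>Converse to \<open>poly_\<mu>_eq_0\<close>, in place of diagonalising \<open>P\<close>.
  The annihilator of degree \<open>d + 1\<close> vanishes at \<open>d + 1\<close> distinct
  eigenvalues, so it is a nonzero multiple of the product of their linear factors, and that product
  divides \<open>h\<close>.\<close>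

lemma matrix_poly_eq_0_if:
  assumes "\<And>j. j \<le> d \<Longrightarrow> poly h (\<mu> j) = 0" "u \<in> V" "v \<in> V"
  shows "mp h u v = 0"
proof -
  let ?m = "\<Prod>a\<in>\<mu> ` {..d}. [:- a, 1:]"
  obtain g where g: "degree g = Suc d" "\<And>u v. u \<in> V \<Longrightarrow> v \<in> V \<Longrightarrow> mp g u v = 0"
    using exists_annihilator by blast
  have "?m dvd g" using poly_\<mu>_eq_0[OF g(2)] by (intro prod_linear_dvd) auto
  then obtain c where c: "g = ?m * c" by (auto simp: dvd_def)
  have "g \<noteq> 0" using g(1) by auto
  then have "?m \<noteq> 0" "c \<noteq> 0" using c by auto
  moreover have "degree ?m = Suc d"
    using \<mu>_inj by (subst degree_prod_eq_sum_degree) (auto simp: card_image)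
  ultimately have "degree c = 0" using g(1) c degree_mult_eq[of ?m c] by simp
  then obtain b where b: "c = [:b:]" by (rule degree_eq_zeroE)
  then have "b \<noteq> 0" using \<open>c \<noteq> 0\<close> by simp
  have "?m dvd h" using assms(1) by (intro prod_linear_dvd) auto
  then obtain q where "h = ?m * q" by (auto simp: dvd_def)
  then have "smult b h = g * q" using c b by simp
  moreover have "mp (g * q) u v = 0"
    using g(2) assms(2) by (subst matrix_poly_mult) auto
  ultimately show ?thesis using \<open>b \<noteq> 0\<close> by (metis matrix_poly_smult mult_eq_0_iff)
qed

lemma \<mu>_0: "\<mu> 0 = 1"
proof -
  obtain j where j: "j \<le> d" "complex_of_real (\<mu> j) = 1"
    using one_is_eigenvalue spectrum by (metis (mono_tags, lifting) atMost_iff imageE mem_Collect_eq)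
  have "\<mu> j \<le> \<mu> 0" using \<mu>_decreasing[of 0 j] j(1) by (cases "j = 0") auto
  moreover have "\<mu> 0 \<le> 1"
    using spectrum by (intro eigenvalue_le_1) blast
  ultimately show ?thesis using j(2) by simp
qed

text \<open>On the spectrum \<open>e\<close> takes only the values \<open>0\<close> and
  \<open>c\<close>. As \<open>e(P)\<close> is symmetric, the diagonal of its square consists of sums
  of squares, which ties the sign of its diagonal to \<open>c\<close>.\<close>

lemma matrix_poly_diag:
  assumes "u \<in> V" "\<And>l. l \<le> d \<Longrightarrow> poly (e * e - smult c e) (\<mu> l) = 0"
  shows "c * mp e u u = (\<Sum>w\<in>V. (mp e u w)\<^sup>2)"
proof -
  have "mp (e * e - smult c e) u u = 0" using assms(2,1,1) by (rule matrix_poly_eq_0_if)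
  moreover have "mp (e * e) u u = (\<Sum>w\<in>V. mp e u w * mp e w u)"
    using assms(1) by (simp add: matrix_poly_mult)
  moreover have "\<dots> = (\<Sum>w\<in>V. (mp e u w)\<^sup>2)"
    using matrix_poly_sym[OF assms(1)] by (intro sum.cong) (auto simp: power2_eq_square)
  ultimately show ?thesis by (simp add: matrix_poly_diff matrix_poly_smult)
qed

text \<open>
  Suppose \<open>f\<close> takes the same value at \<open>\<mu> j\<close> and \<open>\<mu> (j + 1)\<close>, and let \<open>q\<close> be the polynomial of degree
  \<open>d - 1\<close> vanishing at all other eigenvalues. Then \<open>f q\<close> is \<open>\<plusminus>q\<close> on the spectrum, so the diagonal of
  \<open>q(P)\<close> consists, up to sign, of entries of \<open>q(P)\<close> at distance \<open>d\<close>, which vanish for degree reasons.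
  But \<open>q\<close> has the same sign at \<open>\<mu> j\<close> and \<open>\<mu> (j + 1)\<close>, so \<open>q(P)\<close> is semidefinite and nonzero.
\<close>

lemma antipodal_poly_alternates:
  assumes anti: "p d d 0 = 1"
    and f: "\<And>u v. u \<in> V \<Longrightarrow> v \<in> V \<Longrightarrow> mp f u v = (if D u v = d then 1 else 0)"
    and j: "Suc j \<le> d"
    and sq: "poly f (\<mu> j) ^ 2 = 1" "poly f (\<mu> (Suc j)) ^ 2 = 1"
  shows "poly f (\<mu> (Suc j)) = - poly f (\<mu> j)"
proof (rule ccontr)
  assume neq: "poly f (\<mu> (Suc j)) \<noteq> - poly f (\<mu> j)"
  define e where "e = poly f (\<mu> j)"
  have e': "poly f (\<mu> (Suc j)) = e" using neq sq by (auto simp: power2_eq_1_iff e_def)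
  define I where "I = {..d} - {j, Suc j}"
  define q where "q = (\<Prod>l\<in>I. [:- \<mu> l, 1:])"
  have degq: "degree q = d - 1"
  proof -
    have "card I = d - 1" using j by (auto simp: I_def card_Diff_subset)
    then show ?thesis unfolding q_def by (subst degree_prod_eq_sum_degree) auto
  qed
  have q0: "poly q (\<mu> l) = 0" if "l \<le> d" "l \<noteq> j" "l \<noteq> Suc j" for l
    using that by (auto simp: q_def poly_prod I_def)
  have qpos: "poly q (\<mu> j) * poly q (\<mu> (Suc j)) > 0"
  proof -
    \<comment> \<open>No eigenvalue lies between \<mu> (j + 1) and \<mu> j, so both differences have
      the same sign.\<close>
    have "(\<mu> j - \<mu> l) * (\<mu> (Suc j) - \<mu> l) > 0" if "l \<in> I" for l
    proof (cases "l < j")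
      case True
      then show ?thesis
        using \<mu>_decreasing[of l j] \<mu>_decreasing[of l "Suc j"] j by (intro mult_neg_neg) auto
    next
      case False
      then show ?thesis
        using that \<mu>_decreasing[of j l] \<mu>_decreasing[of "Suc j" l] by (intro mult_pos_pos) (auto simp: I_def)
    qed
    then have "(\<Prod>l\<in>I. (\<mu> j - \<mu> l) * (\<mu> (Suc j) - \<mu> l)) > 0" by (rule prod_pos)
    then show ?thesis by (simp add: q_def poly_prod prod.distrib)
  qed
  have diag: "mp q u u = 0" if u: "u \<in> V" for u
  proof -
    obtain a where a: "a \<in> V" "\<And>w. w \<in> V \<Longrightarrow> D a w = d \<longleftrightarrow> w = u"
      using antipode[OF anti u] by metis
    have "mp (f * q - smult e q) a u = 0"
      using a(1) u
    proof (intro matrix_poly_eq_0_if)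
      fix l assume "l \<le> d"
      then show "poly (f * q - smult e q) (\<mu> l) = 0"
        using q0[of l] e' by (cases "l = j \<or> l = Suc j") (auto simp: e_def)
    qed auto
    then have "mp (f * q) a u = e * mp q a u" by (simp add: matrix_poly_diff matrix_poly_smult)
    moreover have "mp q a u = 0"
      using a(1) a(2)[OF u] u degq diameter_pos by (intro matrix_poly_eq_0) auto
    moreover have "mp (f * q) a u = (\<Sum>w\<in>V. mp f a w * mp q w u)"
      using a(1) by (simp add: matrix_poly_mult)
    moreover have "\<dots> = (\<Sum>w\<in>V. if w = u then mp q w u else 0)"
      using a f by (intro sum.cong) auto
    ultimately show ?thesis using u by simp
  qed
  \<comment> \<open>On the spectrum \<open>e1\<close> is zero except for the value \<open>c1\<close>
    at \<mu> j, \<open>e2\<close> is zero except for \<open>c2\<close> at \<mu> (j + 1), and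
    \<open>e1 - e2 = \<delta> q\<close>. The zero diagonal of \<open>q(P)\<close> makes the
    diagonals of \<open>e1(P)\<close> and \<open>e2(P)\<close> equal, while \<open>c1\<close> and
    \<open>c2\<close> have opposite signs.\<close>
  define e1 where "e1 = [:- \<mu> (Suc j), 1:] * q"
  define e2 where "e2 = [:- \<mu> j, 1:] * q"
  define \<delta> where "\<delta> = \<mu> j - \<mu> (Suc j)"
  have "\<delta> > 0" using \<mu>_decreasing[of j "Suc j"] j by (simp add: \<delta>_def)
  define c1 where "c1 = poly q (\<mu> j) * \<delta>"
  define c2 where "c2 = - poly q (\<mu> (Suc j)) * \<delta>"
  have "c1 * c2 = - (poly q (\<mu> j) * poly q (\<mu> (Suc j)) * \<delta>\<^sup>2)"
    by (simp add: c1_def c2_def power2_eq_square)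
  then have c: "c1 * c2 < 0" using qpos \<open>\<delta> > 0\<close> by simp
  have idem1: "poly (e1 * e1 - smult c1 e1) (\<mu> l) = 0" if "l \<le> d" for l
    using q0[OF that] by (cases "l = j \<or> l = Suc j") (auto simp: e1_def c1_def \<delta>_def algebra_simps)
  have idem2: "poly (e2 * e2 - smult c2 e2) (\<mu> l) = 0" if "l \<le> d" for l
    using q0[OF that] by (cases "l = j \<or> l = Suc j") (auto simp: e2_def c2_def \<delta>_def algebra_simps)
  have "mp e1 u w = 0" if uw: "u \<in> V" "w \<in> V" for u w
  proof -
    have "e1 - e2 = ([:- \<mu> (Suc j), 1:] - [:- \<mu> j, 1:]) * q"
      by (simp only: e1_def e2_def left_diff_distrib)
    also have "[:- \<mu> (Suc j), 1:] - [:- \<mu> j, 1:] = [:\<delta>:]" by (simp add: \<delta>_def)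
    also have "[:\<delta>:] * q = smult \<delta> q" by simp
    finally have "mp e1 u u - mp e2 u u = \<delta> * mp q u u"
      by (metis matrix_poly_diff matrix_poly_smult)
    then have "mp e1 u u = mp e2 u u" using diag[OF uw(1)] by simp
    then have "c1 * mp e1 u u \<ge> 0" "c2 * mp e1 u u \<ge> 0"
      using matrix_poly_diag[OF uw(1) idem1] matrix_poly_diag[OF uw(1) idem2]
      by (simp_all add: sum_nonneg)
    then have "(c1 * mp e1 u u) * (c2 * mp e1 u u) \<ge> 0" by (rule mult_nonneg_nonneg)
    then have "(c1 * c2) * (mp e1 u u)\<^sup>2 \<ge> 0" by (simp only: power2_eq_square mult_ac)
    then have "mp e1 u u = 0" using mult_neg_pos[OF c, of "(mp e1 u u)\<^sup>2"] by fastforce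
    then have "(\<Sum>w\<in>V. (mp e1 u w)\<^sup>2) = 0" using matrix_poly_diag[OF uw(1) idem1] by simp
    then show ?thesis using uw(2) by (simp add: sum_nonneg_eq_0_iff)
  qed
  then have "poly e1 (\<mu> j) = 0" using j by (intro poly_\<mu>_eq_0) auto
  then show False using qpos \<open>\<delta> > 0\<close> by (auto simp: e1_def \<delta>_def)
qed

text \<open>\<open>f(P)\<close> exchanges each vertex with its antipode, an involution, so
  \<open>f\<close> is 1 or -1 at each eigenvalue. The row sum gives 1 at \<open>\<mu> 0 = 1\<close>,
  and the signs alternate from there.\<close>

lemma antipodal_poly_values:
  assumes anti: "p d d 0 = 1"
    and f: "\<And>u v. u \<in> V \<Longrightarrow> v \<in> V \<Longrightarrow> mp f u v = (if D u v = d then 1 else 0)"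
    and "j \<le> d"
  shows "poly f (\<mu> j) = (- 1) ^ j"
proof -
  have sq: "poly f (\<mu> j) ^ 2 = 1" if "j \<le> d" for j
  proof -
    have "mp (f * f - 1) u v = 0" if uv: "u \<in> V" "v \<in> V" for u v
    proof -
      obtain a where a: "a \<in> V" "\<And>w. w \<in> V \<Longrightarrow> D u w = d \<longleftrightarrow> w = a"
          "\<And>w. w \<in> V \<Longrightarrow> D a w = d \<longleftrightarrow> w = u"
        using antipode[OF anti uv(1)] by metis
      have "mp (f * f) u v = (\<Sum>w\<in>V. mp f u w * mp f w v)"
        using uv by (simp add: matrix_poly_mult)
      also have "\<dots> = (\<Sum>w\<in>V. if w = a then if v = u then 1 else 0 else 0)"
        using uv a f by (intro sum.cong) auto
      also have "\<dots> = (if u = v then 1 else 0)" using a(1) by auto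
      finally show ?thesis by (simp add: matrix_poly_diff)
    qed
    from poly_\<mu>_eq_0[OF this that] show ?thesis by (simp add: power2_eq_square)
  qed
  obtain u where u: "u \<in> V" using verts_nonempty by auto
  have "poly f 1 = (\<Sum>v\<in>V. if D u v = d then 1 else 0)"
    using matrix_poly_row_sum[OF u, of f] f[OF u] by simp
  also have "\<dots> = card {v \<in> V. D u v = d}" by (simp add: sum.If_cases Int_def)
  also have "\<dots> = 1" using sphere_card[OF u] anti by simp
  finally have "poly f 1 = 1" by simp
  with \<open>j \<le> d\<close> show ?thesis
  proof (induction j)
    case 0
    then show ?case using \<mu>_0 by simp
  next
    case (Suc j)
    then show ?case using antipodal_poly_alternates[OF anti f Suc.prems(1) sq sq] by simp
  qed
qed

end

section \<open>The Grover walk\<close>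

text \<open>\<open>cheb_W n\<close> is the Chebyshev polynomial of the second kind of degree \<open>n - 1\<close>.\<close>

primrec cheb_W :: "nat \<Rightarrow> real poly" where
  "cheb_W 0 = 0"
| "cheb_W (Suc n) = [:0, 1:] * cheb_W n + cheb_T n"

text \<open>Addition formula: for \<open>x = cos t\<close>, \<open>cheb_T n\<close> is
  \<open>cos (n t)\<close> and \<open>cheb_W n\<close> is \<open>sin (n t) / sin t\<close>. With the
  recursion of \<open>cheb_W\<close> this is a first-order system.\<close>

lemma cheb_T_Suc: "cheb_T (Suc n) = [:0, 1:] * cheb_T n + ([:0, 1:] ^ 2 - 1) * cheb_W n"
proof (induction n)
  case 0
  then show ?case by simp
next
  case (Suc n)
  define x :: "real poly" where "x = [:0, 1:]"
  have x2: "[:0, 2:] = 2 * x" by (simp add: x_def numeral_poly)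
  have IH: "(x\<^sup>2 - 1) * cheb_W n = cheb_T (Suc n) - x * cheb_T n"
    using Suc.IH unfolding x_def by (simp only: add_diff_cancel_left')
  have "x * cheb_T (Suc n) + (x\<^sup>2 - 1) * cheb_W (Suc n)
      = x * cheb_T (Suc n) + x * ((x\<^sup>2 - 1) * cheb_W n) + (x\<^sup>2 - 1) * cheb_T n"
    unfolding cheb_W.simps x_def[symmetric] by (simp only: ring_distribs mult_ac add_ac)
  also have "\<dots> = 2 * x * cheb_T (Suc n) - cheb_T n"
    unfolding IH by (simp add: algebra_simps power2_eq_square)
  finally show ?case unfolding cheb_T.simps x2 x_def[symmetric] by simp
qed

text \<open>The identity \<open>cos^2 + sin^2 = 1\<close> in polynomial form.\<close>

lemma cheb_pell: "(cheb_T n)\<^sup>2 - ([:0, 1:] ^ 2 - 1) * (cheb_W n)\<^sup>2 = 1"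
proof (induction n)
  case 0
  then show ?case by simp
next
  case (Suc n)
  have "(x * t + (x\<^sup>2 - 1) * w)\<^sup>2 - (x\<^sup>2 - 1) * (x * w + t)\<^sup>2 = t\<^sup>2 - (x\<^sup>2 - 1) * w\<^sup>2"
    for x t w :: "real poly" by algebra
  then show ?case unfolding cheb_T_Suc cheb_W.simps using Suc.IH by metis
qed

lemma poly_cheb_T_1: "poly (cheb_T n) 1 = 1"
  by (induction n) (simp_all add: cheb_T_Suc del: cheb_T.simps(2,3))

section \<open>The walk on arcs and its closed form\<close>

context distance_regular_graph
begin

lemma sum_arcs: "(\<Sum>a\<in>E. f a) = (\<Sum>w\<in>V. \<Sum>z | (w, z) \<in> E. f (w, z))"
proof -
  have "E = Sigma V (\<lambda>w. {z. (w, z) \<in> E})" using in_arcsD1 by auto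
  moreover have "finite {z. (w, z) \<in> E}" if "w \<in> V" for w
    using out_neighbours[OF that] by simp
  ultimately show ?thesis by (subst sum.Sigma) auto
qed

lemma sum_arcs_swap: "(\<Sum>a\<in>E. f (prod.swap a)) = (\<Sum>a\<in>E. f a)"
  by (rule sum.reindex_bij_witness[of _ prod.swap prod.swap]) (auto dest: arc_sym)

lemma sum_in_arcs: "(\<Sum>b | b \<in> E \<and> snd b = w. f b) = (\<Sum>z | (w, z) \<in> E. f (z, w))"
  by (rule sum.reindex_bij_witness[of _ "\<lambda>z. (z, w)" fst]) (auto dest: arc_sym)

lemma vertex_state_eq:
  assumes "u \<in> V" "a \<in> E"
  shows "vertex_state G u a = of_real ((if snd a = u then 1 else 0) / sqrt valency)"
proof -
  have "vertex_state G u a = (\<Sum>w\<in>V. if w = u then cnj (boundary_matrix G u a) else 0)"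
    unfolding vertex_state_def mvmult_def madjoint_def by (intro sum.cong) auto
  then show ?thesis using assms(1) by (auto simp: boundary_matrix_eq)
qed

text \<open>The factor \<open>S\<close> on the left moves the row index to the reversed arc, whose
  terminus is \<open>fst a\<close>.\<close>

lemma grover_matrix_eq:
  assumes "a \<in> E" "b \<in> E"
  shows "grover_matrix G a b
    = (if snd b = fst a then 2 / of_nat valency else 0) - (if b = prod.swap a then 1 else 0)"
proof -
  define M where "M = (\<lambda>a b. 2 * mmult V (madjoint (boundary_matrix G)) (boundary_matrix G) a b
    - mident a b)"
  have "grover_matrix G a b = (\<Sum>c\<in>E. if c = prod.swap a then M c b else 0)"
    unfolding grover_matrix_def mmult_def[of E] M_def[symmetric]
    by (intro sum.cong) (auto simp: shift_matrix_def)
  also have "\<dots> = M (prod.swap a) b" using arc_swap[OF assms(1)] by simp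
  finally have 1: "grover_matrix G a b = M (prod.swap a) b" .
  have "mmult V (madjoint (boundary_matrix G)) (boundary_matrix G) (prod.swap a) b
      = (\<Sum>w\<in>V. if w = fst a then if snd b = fst a then 1 / of_nat valency else 0 else 0)"
    unfolding mmult_def madjoint_def
    using sqrt_valency_square by (intro sum.cong) (auto simp: boundary_matrix_eq)
  also have "\<dots> = (if snd b = fst a then 1 / of_nat valency else 0)"
    using assms(1) arc_fst_in_verts by simp
  finally show ?thesis unfolding 1 M_def by (auto simp: mident_def)
qed

lemma grover_apply:
  assumes "a \<in> E"
  shows "mvmult E (grover_matrix G) x a
    = 2 / of_nat valency * (\<Sum>z | (fst a, z) \<in> E. x (z, fst a)) - x (prod.swap a)"
proof -
  have "mvmult E (grover_matrix G) x a
      = (\<Sum>b\<in>E. if snd b = fst a then 2 / of_nat valency * x b else 0)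
        - (\<Sum>b\<in>E. if b = prod.swap a then x b else 0)"
    unfolding mvmult_def sum_subtractf[symmetric]
    by (intro sum.cong) (auto simp: grover_matrix_eq[OF assms] algebra_simps)
  also have "(\<Sum>b\<in>E. if b = prod.swap a then x b else 0) = x (prod.swap a)"
    using arc_swap[OF assms] by simp
  also have "(\<Sum>b\<in>E. if snd b = fst a then 2 / of_nat valency * x b else 0)
      = 2 / of_nat valency * (\<Sum>b | b \<in> E \<and> snd b = fst a. x b)"
    by (simp add: sum.If_cases sum_distrib_left Int_def)
  finally show ?thesis by (simp add: sum_in_arcs)
qed

definition walk_state :: "nat \<Rightarrow> 'v \<Rightarrow> 'v \<times> 'v \<Rightarrow> complex" where
  "walk_state n u = mvmult E (mpower E (grover_matrix G) n) (vertex_state G u)"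

lemma walk_state_0: "a \<in> E \<Longrightarrow> walk_state 0 u a = vertex_state G u a"
proof -
  assume a: "a \<in> E"
  have "walk_state 0 u a = (\<Sum>b\<in>E. if b = a then vertex_state G u a else 0)"
    unfolding walk_state_def mvmult_def by (intro sum.cong) (auto simp: mident_def)
  then show ?thesis using a by simp
qed

lemma walk_state_Suc: "walk_state (Suc n) u a = mvmult E (grover_matrix G) (walk_state n u) a"
  unfolding walk_state_def mvmult_def mpower.simps mmult_def
  by (simp add: sum_distrib_left sum_distrib_right mult.assoc, subst sum.swap, rule refl)

lemma matrix_poly_X: "mp ([:0, 1:] * h) u v = (\<Sum>w\<in>V. P u w * mp h w v)"
  by (simp add: matrix_poly_pCons)

lemma neighbour_sum:
  "u \<in> V \<Longrightarrow> (\<Sum>z | (u, z) \<in> E. mp h z v) = valency * mp ([:0, 1:] * h) u v"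
  using P_sum_eq[of u "\<lambda>w. mp h w v"] valency_pos unfolding matrix_poly_X by simp

text \<open>One step of the walk sends \<open>\<alpha>(fst a) + \<beta>(snd a)\<close> to
  \<open>(2 P \<alpha> + \<beta>)(fst a) - \<alpha>(snd a)\<close>. The two polynomials solve this
  recurrence, starting from the vertex state, where \<alpha> is zero.\<close>

lemma walk_state_eq:
  assumes "u \<in> V" "a \<in> E"
  shows "walk_state n u a = of_real
    ((mp (cheb_W n) (fst a) u + mp (cheb_T n - [:0, 1:] * cheb_W n) (snd a) u) / sqrt valency)"
  using assms(2)
proof (induction n arbitrary: a)
  case 0
  then show ?case using assms(1) by (simp add: walk_state_0 vertex_state_eq)
next
  case (Suc n)
  let ?w = "fst a"
  have w: "?w \<in> V" using Suc.prems by (rule arc_fst_in_verts)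
  let ?W = "mp (cheb_W n)" and ?R = "mp (cheb_T n - [:0, 1:] * cheb_W n)"
  have "walk_state (Suc n) u a
      = 2 / of_nat valency * (\<Sum>z | (?w, z) \<in> E. walk_state n u (z, ?w)) - walk_state n u (prod.swap a)"
    unfolding walk_state_Suc by (rule grover_apply[OF Suc.prems])
  also have "(\<Sum>z | (?w, z) \<in> E. walk_state n u (z, ?w))
      = (\<Sum>z | (?w, z) \<in> E. of_real ((?W z u + ?R ?w u) / sqrt valency))"
    using Suc.IH arc_sym by (intro sum.cong) auto
  also have "\<dots> = of_real (((\<Sum>z | (?w, z) \<in> E. ?W z u) + valency * ?R ?w u) / sqrt valency)"
    using card_neighbours[OF w] by (simp add: sum.distrib flip: sum_divide_distrib of_real_sum)
  also have "walk_state n u (prod.swap a) = of_real ((?W (snd a) u + ?R (fst a) u) / sqrt valency)"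
    using Suc.IH[OF arc_swap[OF Suc.prems]] by simp
  also have "2 / of_nat valency * of_real (((\<Sum>z | (?w, z) \<in> E. ?W z u) + valency * ?R ?w u) / sqrt valency)
        - of_real ((?W (snd a) u + ?R (fst a) u) / sqrt valency)
      = complex_of_real ((2 / valency * ((\<Sum>z | (?w, z) \<in> E. ?W z u) + valency * ?R ?w u)
          - (?W (snd a) u + ?R (fst a) u)) / sqrt valency)"
    by (simp add: diff_divide_distrib)
  also have "2 / valency * ((\<Sum>z | (?w, z) \<in> E. ?W z u) + valency * ?R ?w u)
      = 2 * mp ([:0, 1:] * cheb_W n) ?w u + 2 * ?R ?w u"
    using valency_pos by (simp add: neighbour_sum[OF w] field_simps del: mult_pCons_left)
  also have "2 * mp ([:0, 1:] * cheb_W n) ?w u + 2 * ?R ?w u - (?W (snd a) u + ?R (fst a) u)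
      = mp (cheb_W (Suc n)) ?w u - ?W (snd a) u"
    by (simp add: matrix_poly_add matrix_poly_diff del: mult_pCons_left)
  also have "\<dots> = mp (cheb_W (Suc n)) ?w u + mp (cheb_T (Suc n) - [:0, 1:] * cheb_W (Suc n)) (snd a) u"
  proof -
    have "x * t + (x\<^sup>2 - 1) * w - x * (x * w + t) = smult (- 1) w" for x t w :: "real poly"
      by (simp add: algebra_simps power2_eq_square)
    then have "cheb_T (Suc n) - [:0, 1:] * cheb_W (Suc n) = smult (- 1) (cheb_W n)"
      unfolding cheb_T_Suc cheb_W.simps by blast
    then show ?thesis by (simp only: matrix_poly_smult)
  qed
  finally show ?case .
qed

text \<open>Summing over the arcs that end in \<open>w\<close> applies the boundary matrix: the
  average of \<open>cheb_W\<close> over the neighbours of \<open>w\<close> cancels the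
  \<open>x * cheb_W\<close> term and leaves \<open>cheb_T\<close>.\<close>

lemma pst_between_imp:
  assumes "pst_between G \<tau> u v"
  obtains \<gamma> where "cmod \<gamma> = 1"
    "\<And>w. w \<in> V \<Longrightarrow> complex_of_real (mp (cheb_T \<tau>) w u) = (if w = v then \<gamma> else 0)"
proof -
  from assms obtain \<gamma> where \<gamma>: "cmod \<gamma> = 1" "u \<in> V" "v \<in> V"
      "\<And>a. a \<in> E \<Longrightarrow> walk_state \<tau> u a = \<gamma> * vertex_state G v a"
    unfolding pst_between_def walk_state_def by blast
  have s: "sqrt valency \<noteq> 0" using valency_pos by simp
  have "complex_of_real (mp (cheb_T \<tau>) w u) = (if w = v then \<gamma> else 0)" if w: "w \<in> V" for w
  proof -
    let ?W = "mp (cheb_W \<tau>)" and ?R = "mp (cheb_T \<tau> - [:0, 1:] * cheb_W \<tau>)"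
    have "complex_of_real (?W z u + ?R w u) = (if w = v then \<gamma> else 0)" if "(w, z) \<in> E" for z
      using \<gamma>(4)[OF arc_sym[OF that]] walk_state_eq[OF \<gamma>(2) arc_sym[OF that]]
        vertex_state_eq[OF \<gamma>(3) arc_sym[OF that]] s
      by (auto simp: field_simps split: if_splits)
    then have "(\<Sum>z | (w, z) \<in> E. complex_of_real (?W z u + ?R w u))
        = (\<Sum>z | (w, z) \<in> E. if w = v then \<gamma> else 0)"
      by (intro sum.cong) auto
    also have "\<dots> = of_nat valency * (if w = v then \<gamma> else 0)"
      by (simp add: card_neighbours[OF w])
    also have "(\<Sum>z | (w, z) \<in> E. complex_of_real (?W z u + ?R w u))
        = of_nat valency * complex_of_real (mp (cheb_T \<tau>) w u)"
    proof -
      have "(\<Sum>z | (w, z) \<in> E. ?W z u + ?R w u) = (\<Sum>z | (w, z) \<in> E. ?W z u) + valency * ?R w u"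
        by (simp add: sum.distrib card_neighbours[OF w])
      also have "\<dots> = valency * mp (cheb_T \<tau>) w u"
        unfolding neighbour_sum[OF w] matrix_poly_diff by (simp add: right_diff_distrib)
      finally have "(\<Sum>z | (w, z) \<in> E. ?W z u + ?R w u) = valency * mp (cheb_T \<tau>) w u" .
      then show ?thesis by (metis of_real_mult of_real_of_nat_eq of_real_sum)
    qed
    finally show ?thesis using valency_pos by (auto split: if_splits)
  qed
  then show ?thesis using that \<gamma>(1) by blast
qed

text \<open>
  This takes the place of the unitarity of the walk: it is applied to the columns \<open>\<alpha> = W\<^sub>\<tau>(P) e\<^sub>u\<close> and
  \<open>\<beta> = P \<alpha>\<close>. Summing over the neighbours turns \<open>\<Sum>\<^sub>a (\<alpha>(fst a) - \<beta>(snd a))\<^sup>2\<close> into \<open>0\<close>.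
\<close>

lemma arc_function_eq:
  assumes \<beta>: "\<And>w. w \<in> V \<Longrightarrow> \<beta> w = (\<Sum>z\<in>V. P w z * \<alpha> z)"
    and \<alpha>: "\<And>w. w \<in> V \<Longrightarrow> \<alpha> w = (\<Sum>z\<in>V. P w z * \<beta> z)"
    and "a \<in> E"
  shows "\<alpha> (fst a) = \<beta> (snd a)"
proof -
  have nb: "(\<Sum>z | (w, z) \<in> E. f z) = valency * (\<Sum>z\<in>V. P w z * f z)" if "w \<in> V" for w and f :: "'v \<Rightarrow> real"
    using P_sum_eq[OF that, of f] valency_pos by simp
  have sq: "(\<Sum>a\<in>E. (f (fst a))\<^sup>2) = valency * (\<Sum>w\<in>V. (f w)\<^sup>2)" for f :: "'v \<Rightarrow> real"
    by (simp add: sum_arcs card_neighbours sum_distrib_left)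
  have cross: "(\<Sum>a\<in>E. f (fst a) * g (snd a)) = valency * (\<Sum>w\<in>V. (f w)\<^sup>2)"
    if "\<And>w. w \<in> V \<Longrightarrow> f w = (\<Sum>z\<in>V. P w z * g z)" for f g :: "'v \<Rightarrow> real"
  proof -
    have "(\<Sum>a\<in>E. f (fst a) * g (snd a)) = (\<Sum>w\<in>V. f w * (\<Sum>z | (w, z) \<in> E. g z))"
      by (simp add: sum_arcs sum_distrib_left)
    also have "\<dots> = (\<Sum>w\<in>V. valency * (f w)\<^sup>2)"
      using that nb by (intro sum.cong) (auto simp: power2_eq_square)
    finally show ?thesis by (simp add: sum_distrib_left)
  qed
  \<comment> \<open>The cross term is kept twice because it is evaluated in two ways: \<alpha> = P
    \<beta> turns one copy into the sum of squares of \<alpha>, \<beta> = P \<alpha> the other into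
    that of \<beta>.\<close>
  have "(\<Sum>a\<in>E. (\<alpha> (fst a) - \<beta> (snd a))\<^sup>2)
      = (\<Sum>a\<in>E. (\<alpha> (fst a))\<^sup>2) + (\<Sum>a\<in>E. (\<beta> (snd a))\<^sup>2)
        - (\<Sum>a\<in>E. \<alpha> (fst a) * \<beta> (snd a)) - (\<Sum>a\<in>E. \<beta> (snd a) * \<alpha> (fst a))"
    unfolding sum.distrib[symmetric] sum_subtractf[symmetric]
    by (intro sum.cong) (auto simp: power2_eq_square algebra_simps)
  also have "(\<Sum>a\<in>E. (\<beta> (snd a))\<^sup>2) = (\<Sum>a\<in>E. (\<beta> (fst a))\<^sup>2)"
    using sum_arcs_swap[of "\<lambda>a. (\<beta> (fst a))\<^sup>2"] by simp
  also have "(\<Sum>a\<in>E. \<beta> (snd a) * \<alpha> (fst a)) = (\<Sum>a\<in>E. \<beta> (fst a) * \<alpha> (snd a))"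
    using sum_arcs_swap[of "\<lambda>a. \<beta> (fst a) * \<alpha> (snd a)"] by simp
  finally have "(\<Sum>a\<in>E. (\<alpha> (fst a) - \<beta> (snd a))\<^sup>2) = 0"
    using cross[of \<alpha> \<beta>, OF \<alpha>] cross[of \<beta> \<alpha>, OF \<beta>] by (simp add: sq)
  then show ?thesis using assms(3) by (simp add: sum_nonneg_eq_0_iff)
qed

end

section \<open>The two directions of the equivalence\<close>

context distance_regular_spectrum
begin

text \<open>In \<open>walk_state_eq\<close> the two \<open>cheb_W\<close> terms cancel along every
  arc; the remaining \<open>cheb_T\<close> term is the vertex state of \<open>v\<close>, with phase
  1.\<close>

lemma pst_betweenI:
  assumes T: "\<And>u v. u \<in> V \<Longrightarrow> v \<in> V \<Longrightarrow> mp (cheb_T \<tau>) u v = (if D u v = d then 1 else 0)"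
    and anti: "p d d 0 = 1"
    and uv: "u \<in> V" "v \<in> V" "D u v = d"
  shows "pst_between G \<tau> u v"
proof -
  let ?W = "cheb_W \<tau>"
  \<comment> \<open>Since \<open>cheb_T\<close> squares to one on the spectrum,
    \<open>cheb_pell\<close> makes \<open>(x^2 - 1) * cheb_W\<close> vanish there; hence
    \<open>P^2\<close> fixes \<open>cheb_W(P)\<close>.\<close>
  have W0: "mp ([:0, 1:] * ([:0, 1:] * ?W) - ?W) w z = 0" if "w \<in> V" "z \<in> V" for w z
  proof (rule matrix_poly_eq_0_if[OF _ that])
    fix j assume "j \<le> d"
    then have "poly (cheb_T \<tau>) (\<mu> j) ^ 2 = 1"
      using antipodal_poly_values[OF anti T] by (simp flip: power_mult)
    then have "((\<mu> j)\<^sup>2 - 1) * (poly ?W (\<mu> j))\<^sup>2 = 0"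
      using arg_cong[OF cheb_pell[of \<tau>], of "\<lambda>f. poly f (\<mu> j)"] by simp
    then show "poly ([:0, 1:] * ([:0, 1:] * ?W) - ?W) (\<mu> j) = 0"
      by (auto simp: power2_eq_square algebra_simps)
  qed
  have arc: "mp ?W (fst a) u = mp ([:0, 1:] * ?W) (snd a) u" if "a \<in> E" for a
  proof (rule arc_function_eq[OF _ _ that])
    fix w assume "w \<in> V"
    show "mp ([:0, 1:] * ?W) w u = (\<Sum>z\<in>V. P w z * mp ?W z u)" by (rule matrix_poly_X)
    show "mp ?W w u = (\<Sum>z\<in>V. P w z * mp ([:0, 1:] * ?W) z u)"
      using W0[OF \<open>w \<in> V\<close> uv(1)] unfolding matrix_poly_X[symmetric] by (simp only: matrix_poly_diff)
  qed
  obtain b where b: "\<And>w. w \<in> V \<Longrightarrow> D u w = d \<longleftrightarrow> w = b" using antipode[OF anti uv(1)] by metis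
  have "walk_state \<tau> u a = 1 * vertex_state G v a" if a: "a \<in> E" for a
  proof -
    have sV: "snd a \<in> V" using a by (rule arc_snd_in_verts)
    have "D (snd a) u = d \<longleftrightarrow> snd a = v" using b[OF sV] b[OF uv(2)] uv dist_sym[OF sV uv(1)] by auto
    then show ?thesis
      unfolding walk_state_eq[OF uv(1) a] vertex_state_eq[OF uv(2) a]
      using arc[OF a] T[OF sV uv(1)] by (simp only: matrix_poly_diff) simp
  qed
  moreover have "u \<noteq> v" using uv diameter_pos dist_eq_0_iff[OF uv(1,2)] by auto
  ultimately show ?thesis
    unfolding pst_between_def walk_state_def using uv by (metis norm_one)
qed

lemma exhibits_pst_imp:
  assumes "exhibits_pst G \<tau>"
  shows "p d d 0 = 1"
    and "\<And>u v. u \<in> V \<Longrightarrow> v \<in> V \<Longrightarrow> mp (cheb_T \<tau>) u v = (if D u v = d then 1 else 0)"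
proof -
  obtain x y where xy: "pst_between G \<tau> x y" using assms by (auto simp: exhibits_pst_def)
  then have V: "x \<in> V" "y \<in> V" "x \<noteq> y" by (auto simp: pst_between_def)
  obtain \<gamma> where \<gamma>: "cmod \<gamma> = 1"
      "\<And>w. w \<in> V \<Longrightarrow> complex_of_real (mp (cheb_T \<tau>) w x) = (if w = y then \<gamma> else 0)"
    using pst_between_imp[OF xy] by blast
  obtain \<phi> where \<phi>: "\<And>u v. u \<in> V \<Longrightarrow> v \<in> V \<Longrightarrow> mp (cheb_T \<tau>) u v = \<phi> (D u v)"
    using matrix_poly_dist by blast
  have \<phi>D: "complex_of_real (\<phi> (D x w)) = (if w = y then \<gamma> else 0)" if "w \<in> V" for w
    using \<gamma>(2)[OF that] \<phi>[OF that V(1)] dist_sym[OF that V(1)] by simp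
  \<comment> \<open>\<gamma> is nonzero, so the entry at distance \<open>D x y\<close> is nonzero,
    which happens only at \<open>y\<close>.\<close>
  have unique: "w = y" if "w \<in> V" "D x w = D x y" for w
    using \<phi>D[OF that(1)] \<phi>D[OF V(2)] that(2) \<gamma>(1) by (auto split: if_splits)
  then have "{w \<in> V. D x w = D x y} = {y}" using V by auto
  then have "p (D x y) (D x y) 0 = 1" using sphere_card[OF V(1), of "D x y"] by simp
  moreover have "D x y \<ge> 1" using dist_eq_0_iff[OF V(1,2)] V(3) by simp
  ultimately have Dxy: "D x y = d"
    using singleton_sphere_imp_diameter dist_le_diameter[OF V(1,2)] by blast
  with \<open>p (D x y) (D x y) 0 = 1\<close> show anti: "p d d 0 = 1" by simp
  have \<phi>0: "\<phi> i = 0" if "i < d" for i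
  proof -
    obtain w where w: "w \<in> V" "D x w = i" using exists_at_dist[OF V(1), of i] \<open>i < d\<close> by auto
    then have "w \<noteq> y" using Dxy \<open>i < d\<close> by auto
    then show ?thesis using \<phi>D[OF w(1)] w(2) by simp
  qed
  \<comment> \<open>The row of \<open>x\<close> has a single nonzero entry, and its sum is the value
    of \<open>cheb_T\<close> at 1.\<close>
  have "\<phi> d = 1"
  proof -
    have "mp (cheb_T \<tau>) x w = (if w = y then \<phi> d else 0)" if "w \<in> V" for w
      using \<phi>[OF V(1) that] \<phi>D[OF that] Dxy by auto
    then have "(\<Sum>w\<in>V. mp (cheb_T \<tau>) x w) = (\<Sum>w\<in>V. if w = y then \<phi> d else 0)"
      by (intro sum.cong) auto
    then show ?thesis using matrix_poly_row_sum[OF V(1), of "cheb_T \<tau>"] V(2) by (simp add: poly_cheb_T_1)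
  qed
  show "mp (cheb_T \<tau>) u v = (if D u v = d then 1 else 0)" if "u \<in> V" "v \<in> V" for u v
    using \<phi>[OF that] \<phi>0[of "D u v"] \<open>\<phi> d = 1\<close> dist_le_diameter[OF that] by (cases "D u v = d") auto
qed

theorem exhibits_pst_iff:
  "exhibits_pst G \<tau> \<longleftrightarrow> p d d 0 = 1 \<and> (\<forall>j\<le>d. poly (cheb_T \<tau>) (\<mu> j) = (- 1) ^ j)" (is ?iff)
  and pst_between_antipodal:
  "\<lbrakk>p d d 0 = 1; \<forall>j\<le>d. poly (cheb_T \<tau>) (\<mu> j) = (- 1) ^ j; u \<in> V; v \<in> V; D u v = d\<rbrakk>
    \<Longrightarrow> pst_between G \<tau> u v"
proof -
  show *: "pst_between G \<tau> u v"
    if anti: "p d d 0 = 1" and T: "\<forall>j\<le>d. poly (cheb_T \<tau>) (\<mu> j) = (- 1) ^ j"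
      and uv: "u \<in> V" "v \<in> V" "D u v = d" for u v
  proof (rule pst_betweenI[OF _ anti uv])
    \<comment> \<open>\<open>f(P)\<close> is the distance-\<open>d\<close> matrix. Its values on the
      spectrum are the signs prescribed for \<open>cheb_T\<close>, so \<open>cheb_T - f\<close>
      vanishes there and both matrices agree.\<close>
    obtain f where f: "\<And>u v. u \<in> V \<Longrightarrow> v \<in> V \<Longrightarrow> mp f u v = (if D u v = d then 1 else 0)"
      using exists_matrix_poly[of "Suc d" "\<lambda>i. if i = d then 1 else 0"] by auto
    fix u v assume uv: "u \<in> V" "v \<in> V"
    have "mp (cheb_T \<tau> - f) u v = 0"
      using antipodal_poly_values[OF anti f] T by (intro matrix_poly_eq_0_if[OF _ uv]) simp
    then show "mp (cheb_T \<tau>) u v = (if D u v = d then 1 else 0)"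
      using f[OF uv] by (simp add: matrix_poly_diff)
  qed
  show ?iff
  proof
    assume pst: "exhibits_pst G \<tau>"
    show "p d d 0 = 1 \<and> (\<forall>j\<le>d. poly (cheb_T \<tau>) (\<mu> j) = (- 1) ^ j)"
      using exhibits_pst_imp(1)[OF pst] antipodal_poly_values[OF exhibits_pst_imp[OF pst]] by blast
  next
    assume "p d d 0 = 1 \<and> (\<forall>j\<le>d. poly (cheb_T \<tau>) (\<mu> j) = (- 1) ^ j)"
    then show "exhibits_pst G \<tau>"
      using * diameter_attained unfolding exhibits_pst_def by blast
  qed
qed

end

theorem theorem4p2:
  fixes G :: "'v pair_pre_digraph" and d \<tau> :: nat and \<mu> :: "nat \<Rightarrow> real"
  assumes "distance_regular G"
    and "graph_diameter G = d"
    and "d \<ge> 1"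
    and "\<And>i j. i < j \<Longrightarrow> j \<le> d \<Longrightarrow> \<mu> j < \<mu> i"
    and "{\<theta>. is_eigenvalue (pverts G) (discriminant G) \<theta>} = (\<lambda>j. complex_of_real (\<mu> j)) ` {..d}"
  shows "(exhibits_pst G \<tau> \<longleftrightarrow>
            (antipodal G \<and> (\<forall>F \<in> antipodal_fibres G. card F = 2)) \<and>
            (\<forall>j\<le>d. (even j \<longrightarrow> poly (cheb_T \<tau>) (\<mu> j) = 1) \<and>
                   (odd j \<longrightarrow> poly (cheb_T \<tau>) (\<mu> j) = -1))) \<and>
         ((antipodal G \<and> (\<forall>F \<in> antipodal_fibres G. card F = 2)) \<and>
            (\<forall>j\<le>d. (even j \<longrightarrow> poly (cheb_T \<tau>) (\<mu> j) = 1) \<and>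
                   (odd j \<longrightarrow> poly (cheb_T \<tau>) (\<mu> j) = -1)) \<longrightarrow>
          (\<forall>u \<in> pverts G. \<forall>v \<in> pverts G. graph_dist G u v = d \<longrightarrow> pst_between G \<tau> u v))"
proof -
  obtain p where p: "\<And>u v i j. u \<in> pverts G \<Longrightarrow> v \<in> pverts G \<Longrightarrow>
      card {w \<in> pverts G. graph_dist G u w = i \<and> graph_dist G v w = j} = p i j (graph_dist G u v)"
    and G: "pair_graph G" "Digraph_Component.connected (with_proj G)"
    using assms(1) unfolding distance_regular_def by blast
  interpret distance_regular_spectrum G p \<mu>
    using assms(2-) p G
    by (intro distance_regular_spectrum.intro distance_regular_graph.intro connected_pair_graph.intro
        connected_pair_graph_axioms.intro distance_regular_graph_axioms.intro
        distance_regular_spectrum_axioms.intro) auto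
  have signs: "(\<forall>j\<le>d. (even j \<longrightarrow> poly (cheb_T \<tau>) (\<mu> j) = 1) \<and>
      (odd j \<longrightarrow> poly (cheb_T \<tau>) (\<mu> j) = -1)) \<longleftrightarrow> (\<forall>j\<le>d. poly (cheb_T \<tau>) (\<mu> j) = (- 1) ^ j)"
    by (intro all_cong) (auto simp: minus_one_power_iff)
  show ?thesis
    unfolding signs antipodal_iff exhibits_pst_iff[unfolded assms(2)] assms(2)
    using pst_between_antipodal unfolding assms(2) by blast
qed

end
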